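(* Let $(X,d)$ be a metric space. Let $A\subset X$, let $f:A\to\mathbb{R}$ be a $1$-Lipschitz function and let $M:A\rightrightarrows A$ be a multivalued mapping such that $$f(y)-f(x)=d(x,y)\quad\text{for all }(x,y)\in G(M).$$ Given $\emptyset\neq S\subset\mathrm{dom}(M)$, the function $f|_S$ extends to a $1$-Lipschitz function $h:X\to\mathbb{R}$ which satisfies $$h(y)-h(x)=d(x,y)\quad\text{for all }(x,y)\in G(M).\qquad(\ast)$$ In particular, there exist a minimal and a maximal (with respect to the pointwise order, i.e. least and greatest) function among all $1$-Lipschitz functions $h:X\to\mathbb{R}$ which extend $f|_S$ and satisfy $(\ast)$.
   Context: For a multivalued mapping $M:A\rightrightarrows A$: $G(M)=\{(x,y): y\in M(x)\}$ and $\mathrm{dom}(M)=\{x: M(x)\neq\emptyset\}$. A function $h$ is $1$-Lipschitz if $|h(x)-h(y)|\le d(x,y)$ for all $x,y$ in its domain. *)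

theory Defs
  imports "HOL-Analysis.Analysis"
begin

(* A multivalued mapping M from A to A is a total function M :: 'a => 'a set, mapping
   each point of A to a subset of A; its values at points outside A are irrelevant,
   which is why A is an argument of both definitions below. *)

definition mv_graph :: "'a set \<Rightarrow> ('a \<Rightarrow> 'a set) \<Rightarrow> ('a \<times> 'a) set" where
  "mv_graph A M = {(x, y). x \<in> A \<and> y \<in> M x}"

definition mv_dom :: "'a set \<Rightarrow> ('a \<Rightarrow> 'a set) \<Rightarrow> 'a set" where
  "mv_dom A M = {x \<in> A. M x \<noteq> {}}"

definition lipschitz_extensions ::
  "('a::metric_space) set \<Rightarrow> ('a \<Rightarrow> real) \<Rightarrow> ('a \<Rightarrow> 'a set) \<Rightarrow> 'a set \<Rightarrow> ('a \<Rightarrow> real) set" where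
  "lipschitz_extensions A f M S =
    {h. 1-lipschitz_on UNIV h \<and> (\<forall>x\<in>S. h x = f x) \<and>
        (\<forall>(x, y)\<in>mv_graph A M. h y - h x = dist x y)}"

end

theory Submission
  imports Defs
begin

text \<open>
  The condition \<open>h y - h x = dist x y\<close> on the graph of \<open>M\<close> only involves points of \<open>A\<close>, so
  every 1-Lipschitz extension of all of \<open>f\<close>, rather than of its restriction to \<open>S\<close>, belongs to
  the class in question. Such an extension is McShane's
  \<open>x \<mapsto> INF a\<in>A. f a + dist x a\<close>, an infimum of 1-Lipschitz functions
  (\<open>lipschitz_extension_UNIV\<close>).

  The least element of the class is its pointwise infimum. It is finite because all members
  agree at a point \<open>s\<close> of \<open>S\<close>, and hence are at least \<open>f s - dist x s\<close> at \<open>x\<close>. All constraints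
  survive the infimum: Lipschitz bounds (\<open>lipschitz_on_INF\<close>), prescribed values, and prescribed
  differences \<open>h y = h x + c\<close>, since translation by a constant commutes with infima
  (\<open>least_lipschitz_function\<close>). The greatest element needs no separate argument: negation maps
  the class to one of the same form, with values and differences of opposite sign.
\<close>

text \<open>
  The bound \<open>h i x \<le> h i y + L * dist x y\<close> has a constant independent of \<open>i\<close>, so it passes to
  the infimum.
\<close>

lemma lipschitz_on_INF:
  fixes h :: "'i \<Rightarrow> 'a::metric_space \<Rightarrow> real"
  assumes lip: "\<And>i. i \<in> I \<Longrightarrow> L-lipschitz_on X (h i)"
    and "I \<noteq> {}"
    and bdd: "\<And>x. x \<in> X \<Longrightarrow> bdd_below ((\<lambda>i. h i x) ` I)"
  shows "L-lipschitz_on X (\<lambda>x. INF i\<in>I. h i x)"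
proof -
  have *: "(INF i\<in>I. h i x) \<le> (INF i\<in>I. h i y) + L * dist x y" if "x \<in> X" "y \<in> X" for x y
  proof -
    have "(INF i\<in>I. h i x) - L * dist x y \<le> (INF i\<in>I. h i y)"
    proof (rule cINF_greatest[OF \<open>I \<noteq> {}\<close>])
      fix i assume i: "i \<in> I"
      have "(INF i\<in>I. h i x) \<le> h i x"
        using bdd[OF \<open>x \<in> X\<close>] i by (rule cINF_lower)
      moreover have "\<bar>h i x - h i y\<bar> \<le> L * dist x y"
        using lipschitz_onD[OF lip[OF i] that] by (simp add: dist_real_def)
      ultimately show "(INF i\<in>I. h i x) - L * dist x y \<le> h i y"
        by linarith
    qed
    then show ?thesis by simp
  qed
  show ?thesis
  proof (rule lipschitz_onI)
    fix x y assume "x \<in> X" "y \<in> X"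
    then show "dist (INF i\<in>I. h i x) (INF i\<in>I. h i y) \<le> L * dist x y"
      using *[of x y] *[of y x] by (simp add: dist_real_def dist_commute abs_le_iff)
  next
    show "0 \<le> L"
      using \<open>I \<noteq> {}\<close> lip lipschitz_on_nonneg by blast
  qed
qed

text \<open>
  McShane's extension: \<open>f a + L * dist x a\<close> is the largest value at \<open>x\<close> that the value of \<open>f\<close> at
  \<open>a\<close> permits, and the infimum of these bounds over \<open>a\<close> is itself Lipschitz. At a point
  \<open>x\<close> of \<open>A\<close> the infimum is attained at \<open>a = x\<close>.
\<close>

lemma lipschitz_extension_UNIV:
  fixes f :: "'a::metric_space \<Rightarrow> real"
  assumes f: "L-lipschitz_on A f" and "A \<noteq> {}"
  obtains h where "L-lipschitz_on UNIV h" and "\<And>x. x \<in> A \<Longrightarrow> h x = f x"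
proof
  define h where "h x = (INF a\<in>A. f a + L * dist x a)" for x
  have L: "0 \<le> L" using f by (rule lipschitz_on_nonneg)
  have f_le: "f b - L * dist a b \<le> f a" if "a \<in> A" "b \<in> A" for a b
    using lipschitz_onD[OF f that] by (simp add: dist_real_def)
  obtain b where b: "b \<in> A" using \<open>A \<noteq> {}\<close> by blast
  have bdd: "bdd_below ((\<lambda>a. f a + L * dist x a) ` A)" for x
  proof (rule bdd_belowI2)
    fix a assume "a \<in> A"
    have "L * dist a b \<le> L * (dist x a + dist x b)"
      using dist_triangle3[of a b x] L by (intro mult_left_mono) auto
    then show "f b - L * dist x b \<le> f a + L * dist x a"
      using f_le[OF \<open>a \<in> A\<close> b] by (simp add: algebra_simps)
  qed
  have "L-lipschitz_on UNIV (\<lambda>x. f a + L * dist x a)" for a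
  proof (rule lipschitz_onI[OF _ L])
    fix x y
    have "L * \<bar>dist x a - dist y a\<bar> \<le> L * dist x y"
      using abs_dist_diff_le[of x a y] L by (intro mult_left_mono) (auto simp: dist_commute)
    then show "dist (f a + L * dist x a) (f a + L * dist y a) \<le> L * dist x y"
      using L by (simp add: dist_real_def abs_mult flip: right_diff_distrib)
  qed
  then show "L-lipschitz_on UNIV h"
    unfolding h_def using \<open>A \<noteq> {}\<close> bdd by (intro lipschitz_on_INF)
  fix x assume x: "x \<in> A"
  show "h x = f x"
  proof (rule antisym)
    show "h x \<le> f x"
      unfolding h_def using cINF_lower[OF bdd[of x] x] by simp
    show "f x \<le> h x"
      unfolding h_def
    proof (rule cINF_greatest[OF \<open>A \<noteq> {}\<close>])
      fix a assume "a \<in> A"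
      then show "f x \<le> f a + L * dist x a"
        using f_le[of a x] x by (simp add: dist_commute)
    qed
  qed
qed

text \<open>
  The prescribed differences \<open>c\<close> are arbitrary, of either sign, so that the class of functions
  considered here is stable under negation; this turns least elements into greatest ones.
\<close>

lemma least_lipschitz_function:
  fixes g :: "'a::metric_space \<Rightarrow> real" and c :: "'a \<Rightarrow> 'a \<Rightarrow> real"
    and S :: "'a set" and G :: "('a \<times> 'a) set" and L :: real
  defines "E \<equiv> {h. L-lipschitz_on UNIV h \<and> (\<forall>x\<in>S. h x = g x) \<and>
                   (\<forall>(x, y)\<in>G. h y - h x = c x y)}"
  assumes "S \<noteq> {}" and "E \<noteq> {}"
  shows "\<exists>h\<^sub>0\<in>E. \<forall>h\<in>E. \<forall>x. h\<^sub>0 x \<le> h x"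
proof
  define m where "m x = (INF h\<in>E. h x)" for x
  obtain s where s: "s \<in> S" using \<open>S \<noteq> {}\<close> by blast
  have bdd: "bdd_below ((\<lambda>h. h x) ` E)" for x
  proof (rule bdd_belowI2)
    fix h assume "h \<in> E"
    then have "L-lipschitz_on UNIV h" and "h s = g s" using s by (auto simp: E_def)
    then show "g s - L * dist x s \<le> h x"
      using lipschitz_onD[of L UNIV h x s] by (simp add: dist_real_def)
  qed
  have lower: "m x \<le> h x" if "h \<in> E" for h x
    unfolding m_def using bdd that by (rule cINF_lower)
  have greatest: "t \<le> m x" if "\<And>h. h \<in> E \<Longrightarrow> t \<le> h x" for t x
    unfolding m_def using \<open>E \<noteq> {}\<close> that by (rule cINF_greatest)
  have "L-lipschitz_on UNIV m"
    unfolding m_def using \<open>E \<noteq> {}\<close> bdd by (intro lipschitz_on_INF) (auto simp: E_def)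
  moreover have "m x = g x" if "x \<in> S" for x
  proof -
    have "h x = g x" if "h \<in> E" for h using that \<open>x \<in> S\<close> by (auto simp: E_def)
    moreover obtain h where "h \<in> E" using \<open>E \<noteq> {}\<close> by blast
    ultimately show ?thesis
      using lower[of h x] greatest[of "g x" x] by fastforce
  qed
  moreover have "m y - m x = c x y" if "(x, y) \<in> G" for x y
  proof -
    have diff: "h y = h x + c x y" if "h \<in> E" for h
      using that \<open>(x, y) \<in> G\<close> by (force simp: E_def)
    have "m x + c x y \<le> m y"
    proof (rule greatest)
      fix h assume "h \<in> E"
      then show "m x + c x y \<le> h y" using diff[of h] lower[of h x] by simp
    qed
    moreover have "m y - c x y \<le> m x"
    proof (rule greatest)
      fix h assume "h \<in> E"
      then show "m y - c x y \<le> h x" using diff[of h] lower[of h y] by simp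
    qed
    ultimately show ?thesis by simp
  qed
  ultimately show "m \<in> E" by (auto simp: E_def)
  show "\<forall>h\<in>E. \<forall>x. m x \<le> h x" using lower by blast
qed

lemma greatest_lipschitz_function:
  fixes g :: "'a::metric_space \<Rightarrow> real" and c :: "'a \<Rightarrow> 'a \<Rightarrow> real"
    and S :: "'a set" and G :: "('a \<times> 'a) set" and L :: real
  defines "E \<equiv> {h. L-lipschitz_on UNIV h \<and> (\<forall>x\<in>S. h x = g x) \<and>
                   (\<forall>(x, y)\<in>G. h y - h x = c x y)}"
  assumes "S \<noteq> {}" and "E \<noteq> {}"
  shows "\<exists>h\<^sub>1\<in>E. \<forall>h\<in>E. \<forall>x. h x \<le> h\<^sub>1 x"
proof -
  define E' where "E' = {h. L-lipschitz_on UNIV h \<and> (\<forall>x\<in>S. h x = - g x) \<and>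
                           (\<forall>(x, y)\<in>G. h y - h x = - c x y)}"
  have neg: "(\<lambda>x. - h x) \<in> E' \<longleftrightarrow> h \<in> E" for h
  proof -
    have "- h y + h x = - c x y \<longleftrightarrow> h y - h x = c x y" for x y by linarith
    then show ?thesis by (simp add: E_def E'_def)
  qed
  have "E' \<noteq> {}" using \<open>E \<noteq> {}\<close> neg by blast
  then obtain m where m: "m \<in> E'" "\<And>h x. h \<in> E' \<Longrightarrow> m x \<le> h x"
    using least_lipschitz_function[where S = S and L = L and G = G and g = "\<lambda>x. - g x"
        and c = "\<lambda>x y. - c x y"] \<open>S \<noteq> {}\<close>
    unfolding E'_def by blast
  have "(\<lambda>x. - m x) \<in> E" using m(1) neg[of "\<lambda>x. - m x"] by simp
  moreover have "h x \<le> - m x" if "h \<in> E" for h x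
    using m(2)[of "\<lambda>x. - h x" x] neg that by fastforce
  ultimately show ?thesis by (intro bexI[of _ "\<lambda>x. - m x"]) auto
qed

theorem theorem5p3:
  fixes A S :: "('a::metric_space) set"
    and f :: "'a \<Rightarrow> real"
    and M :: "'a \<Rightarrow> 'a set"
  assumes "1-lipschitz_on A f"
    and "\<And>x. x \<in> A \<Longrightarrow> M x \<subseteq> A"
    and "\<forall>(x, y)\<in>mv_graph A M. f y - f x = dist x y"
    and "S \<noteq> {}"
    and "S \<subseteq> mv_dom A M"
  shows "(\<exists>h. h \<in> lipschitz_extensions A f M S) \<and>
    (\<exists>h\<^sub>0\<in>lipschitz_extensions A f M S. \<forall>h\<in>lipschitz_extensions A f M S. \<forall>x. h\<^sub>0 x \<le> h x) \<and>
    (\<exists>h\<^sub>1\<in>lipschitz_extensions A f M S. \<forall>h\<in>lipschitz_extensions A f M S. \<forall>x. h x \<le> h\<^sub>1 x)"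
proof -
  have "S \<subseteq> A" using assms(5) by (auto simp: mv_dom_def)
  with \<open>S \<noteq> {}\<close> have "A \<noteq> {}" by blast
  with assms(1) obtain h where h: "1-lipschitz_on UNIV h" "\<And>x. x \<in> A \<Longrightarrow> h x = f x"
    by (rule lipschitz_extension_UNIV) blast
  have "h y - h x = dist x y" if "(x, y) \<in> mv_graph A M" for x y
  proof -
    have "x \<in> A" "y \<in> A" using that assms(2) by (auto simp: mv_graph_def)
    then show ?thesis using h(2) assms(3) that by auto
  qed
  then have "h \<in> lipschitz_extensions A f M S"
    using h \<open>S \<subseteq> A\<close> by (auto simp: lipschitz_extensions_def)
  then have ne: "lipschitz_extensions A f M S \<noteq> {}" by blast
  show ?thesis
    using ne least_lipschitz_function[OF \<open>S \<noteq> {}\<close> ne[unfolded lipschitz_extensions_def]]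
      greatest_lipschitz_function[OF \<open>S \<noteq> {}\<close> ne[unfolded lipschitz_extensions_def]]
    unfolding lipschitz_extensions_def by blast
qed

end
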